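(* Let $k=2K+1\geq 5$ be an odd integer and let $\mathcal C$ be the $(K-1)\times(K-1)$ matrix with entries $$\mathcal C_{s,r}=\binom{2K-2s}{2r-1}+\binom{2K-2s}{2K-2r}\qquad(1\le s,r\le K-1).$$ Then $\mathcal C$ is invertible and for all $1\le r,s\le K-1$, $$\big(\mathcal C^{-1}\big)_{r,s}=\frac{-2}{2s-1}\sum_{n=0}^{k-2s}\binom{k-2r-1}{k-2s-n}\binom{n+2s-2}{n}B_n=\frac{2}{2s-1}\sum_{n=0}^{k-2s}\binom{2r-1}{k-2s-n}\binom{n+2s-2}{n}B_n .$$
   Context: $B_n$ denotes the $n$th Bernoulli number, defined by $\frac{t}{e^t-1}=\sum_{n\ge0}B_n\frac{t^n}{n!}$ (so $B_0=1$, $B_1=-\tfrac12$, $B_2=\tfrac16$). Binomial coefficients $\binom{a}{m}$ with $a\ge 0$ are the usual ones, equal to $0$ when $m<0$ or $m>a$. The matrix $\mathcal C$ is the transpose of the matrix $\mathcal A$ whose $(r,s)$-entry is $\binom{2K-2s}{2r-1}+\binom{2K-2s}{2K-2r}$, the coefficient matrix appearing in Zagier's expression of double zeta values $\zeta(2r,k-2r)$ modulo $\mathbb{Q}\zeta(k)$ in terms of products $\zeta(2s)\zeta(k-2s)$. *)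

theory Defs
  imports
    "HOL-Computational_Algebra.Formal_Power_Series"
    "Jordan_Normal_Form.Matrix"
begin

definition bernoulli :: "nat \<Rightarrow> rat" where
  "bernoulli n = fact n * fps_nth (fps_X / (fps_exp 1 - 1)) n"

text \<open>The division of formal power series above is exact.\<close>

lemma bernoulli_gen_fun:
  "Abs_fps (\<lambda>n. bernoulli n / fact n) * (fps_exp 1 - 1) = fps_X"
proof -
  let ?E = "fps_exp 1 - 1 :: rat fps"
  have nz: "?E \<noteq> 0"
  proof
    assume "?E = 0"
    then have "fps_nth ?E 1 = 0" by simp
    then show False by simp
  qed
  have "subdegree ?E = 1"
    by (rule subdegreeI) simp_all
  then have "?E dvd fps_X"
    using nz by (simp add: fps_dvd_iff)
  moreover have "Abs_fps (\<lambda>n. bernoulli n / fact n) = fps_X / ?E"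
    by (simp add: fps_eq_iff bernoulli_def)
  ultimately show ?thesis by simp
qed

text \<open>
  Matrices are indexed from 0, so the entry in row \<open>s\<close> and column \<open>r\<close>
  (\<open>1 \<le> s, r \<le> K - 1\<close>) sits at position \<open>(s - 1, r - 1)\<close>.
\<close>

definition C_mat :: "nat \<Rightarrow> rat mat" where
  "C_mat K = mat (K - 1) (K - 1) (\<lambda>(i, j). let s = i + 1; r = j + 1 in
     of_nat ((2 * K - 2 * s) choose (2 * r - 1)) +
     of_nat ((2 * K - 2 * s) choose (2 * K - 2 * r)))"

end

theory Submission
  imports Defs "Jordan_Normal_Form.Determinant"
begin

text \<open>
  Let \<open>E\<close> be the linear functional on polynomials with \<open>E (z ^ n) = B\<^sub>n\<close>. The generating function
  gives \<open>E (f (- 1 - z)) = E (f z)\<close>. With \<open>d = 2 K - 1\<close> and \<open>q = 2 s - 2\<close>, the sum in the second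
  formula for the entry \<open>(r, s)\<close> is \<open>\<phi> (2 r - 1)\<close>, where \<open>\<phi> m\<close> is \<open>E\<close> applied to the \<open>q\<close>-th
  divided derivative of \<open>(1 + z) ^ m * z ^ (d - m)\<close>. As \<open>d\<close> is odd and \<open>q\<close> even, the reflection
  \<open>z \<mapsto> - 1 - z\<close> yields \<open>\<phi> (d - m) = - \<phi> m\<close>, so the two formulas agree, and the product of row
  \<open>s'\<close> of the matrix with column \<open>s\<close> of the claimed inverse becomes, for \<open>N = 2 K - 2 s'\<close>, the
  alternating sum of \<open>(N choose m) * \<phi> m\<close>. The binomial theorem for \<open>(z - (1 + z)) ^ N\<close>
  collapses it to a multiple of the Bernoulli number of index \<open>2 (s' - s) + 1\<close>, which vanishes
  unless \<open>s' = s\<close>.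
\<close>

section \<open>Reflection and parity of the Bernoulli numbers\<close>

text \<open>Replacing t by -t in b(t) (e^t - 1) = t and multiplying by e^t gives b(-t) (e^t - 1) =
  b(t) e^t (e^t - 1), where e^t - 1 cancels.\<close>

lemma bernoulli_reflect:
  "Abs_fps (\<lambda>n. (- 1) ^ n * bernoulli n / fact n) =
   Abs_fps (\<lambda>n. bernoulli n / fact n) * fps_exp 1"
proof -
  let ?b = "Abs_fps (\<lambda>n. bernoulli n / fact n)"
  let ?c = "Abs_fps (\<lambda>n. (- 1) ^ n * bernoulli n / fact n)"
  let ?E = "fps_exp 1 :: rat fps"
  let ?E' = "fps_exp (-1) :: rat fps"
  have inv: "?E * ?E' = 1"
    by (simp add: fps_exp_add_mult [symmetric])
  have "(?b * (?E - 1)) oo (- fps_X) = - fps_X"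
    by (simp add: bernoulli_gen_fun fps_X_fps_compose_startby0)
  moreover have "?b oo (- fps_X) = ?c"
    by (simp add: fps_compose_uminus' fps_eq_iff)
  moreover have "?E oo (- fps_X) = ?E'"
    by (simp add: fps_compose_uminus' fps_eq_iff)
  ultimately have "?c * (?E' - 1) = - fps_X"
    by (simp add: fps_compose_mult_distrib fps_compose_sub_distrib)
  then have "?c * (?E' - 1) * ?E = - (?b * (?E - 1)) * ?E"
    by (simp add: bernoulli_gen_fun)
  then have "?c * (?E * ?E' - ?E) = - (?b * (?E - 1)) * ?E"
    by (simp add: algebra_simps)
  then have "?c * (?E - 1) = (?b * ?E) * (?E - 1)"
    unfolding inv by (simp add: algebra_simps)
  moreover have "?E - 1 \<noteq> 0"
    using bernoulli_gen_fun by (metis fps_X_neq_zero mult_zero_right)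
  ultimately show ?thesis
    by simp
qed

text \<open>Comparing coefficients of t^n in the reflection identity. Umbrally, this evaluates
  \<open>E\<close> on (1 + z)^n.\<close>

lemma bernoulli_binomial_sum:
  "(\<Sum>i\<le>n. of_nat (n choose i) * bernoulli i) = (- 1) ^ n * bernoulli n"
proof -
  have "(- 1) ^ n * bernoulli n / fact n = (\<Sum>i=0..n. bernoulli i / fact i * (1 / fact (n - i)))"
    using arg_cong [OF bernoulli_reflect, of "\<lambda>f. fps_nth f n"]
    by (simp add: fps_mult_nth)
  then have "(- 1) ^ n * bernoulli n
      = (\<Sum>i=0..n. fact n * (bernoulli i / fact i * (1 / fact (n - i))))"
    unfolding sum_distrib_left [symmetric] by (simp add: field_simps)
  also have "\<dots> = (\<Sum>i\<le>n. of_nat (n choose i) * bernoulli i)"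
    by (intro sum.cong) (auto simp: binomial_fact)
  finally show ?thesis by simp
qed

text \<open>Since b(t) e^t = b(t) + b(t) (e^t - 1) = b(t) + t, reflection changes only the
  coefficient of index 1.\<close>

lemma bernoulli_parity:
  "(- 1) ^ n * bernoulli n = bernoulli n + (if n = 1 then 1 else 0)"
proof -
  let ?b = "Abs_fps (\<lambda>n. bernoulli n / fact n)"
  have "Abs_fps (\<lambda>n. (- 1) ^ n * bernoulli n / fact n) = ?b + ?b * (fps_exp 1 - 1)"
    unfolding bernoulli_reflect by (simp add: algebra_simps)
  also have "\<dots> = ?b + fps_X"
    by (simp add: bernoulli_gen_fun)
  finally have "fps_nth (Abs_fps (\<lambda>n. (- 1) ^ n * bernoulli n / fact n)) n = fps_nth (?b + fps_X) n"
    by (rule arg_cong)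
  then show ?thesis
    by (cases "n = 1") simp_all
qed

lemma bernoulli_1: "bernoulli 1 = - 1 / 2"
  using bernoulli_parity [of 1] by simp

lemma bernoulli_odd_eq_0: "odd n \<Longrightarrow> n \<noteq> 1 \<Longrightarrow> bernoulli n = 0"
  using bernoulli_parity [of n] by simp

section \<open>The umbral functional and its reflection invariance\<close>

definition bernoulli_umbra :: "rat poly \<Rightarrow> rat" where
  "bernoulli_umbra p = (\<Sum>i\<le>degree p. coeff p i * bernoulli i)"

text \<open>Degrees may drop in sums and scalar multiples, so linearity is proved with a common
  upper bound in place of the degree.\<close>

lemma bernoulli_umbra_bound:
  assumes "degree p \<le> N"
  shows "bernoulli_umbra p = (\<Sum>i\<le>N. coeff p i * bernoulli i)"
  unfolding bernoulli_umbra_def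
  using assms by (intro sum.mono_neutral_left) (auto simp: coeff_eq_0)

lemma bernoulli_umbra_add: "bernoulli_umbra (p + q) = bernoulli_umbra p + bernoulli_umbra q"
proof -
  let ?N = "max (degree p) (degree q)"
  show ?thesis
    by (simp add: bernoulli_umbra_bound [of _ ?N] degree_add_le sum.distrib distrib_right)
qed

lemma bernoulli_umbra_smult: "bernoulli_umbra (smult c p) = c * bernoulli_umbra p"
  by (simp add: bernoulli_umbra_bound [of _ "degree p"] degree_smult_le sum_distrib_left mult.assoc)

lemma bernoulli_umbra_sum: "bernoulli_umbra (\<Sum>i\<in>A. f i) = (\<Sum>i\<in>A. bernoulli_umbra (f i))"
  by (induction A rule: infinite_finite_induct)
     (auto simp: bernoulli_umbra_add, simp_all add: bernoulli_umbra_def)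

lemma bernoulli_umbra_monom: "bernoulli_umbra (monom c n) = c * bernoulli n"
  by (simp add: bernoulli_umbra_bound [of _ n] degree_monom_le if_distrib [of "\<lambda>x. x * _"]
      cong: if_cong)

lemma linear_power_expand:
  "[:1, 1:] ^ n = (\<Sum>j\<le>n. monom (of_nat (n choose j)) j :: 'a :: comm_ring_1 poly)"
proof -
  have "[:1, 1:] = [:0, 1:] + (1 :: 'a poly)"
    by (simp add: one_pCons)
  then show ?thesis
    by (simp add: binomial_ring monom_altdef of_nat_poly del: add_pCons)
qed

lemma pcompose_power: "(p ^ n) \<circ>\<^sub>p r = (p \<circ>\<^sub>p r) ^ n"
  for p :: "'a :: comm_semiring_1 poly"
  by (induction n) (simp_all add: pcompose_mult pcompose_1)

text \<open>By linearity monomials suffice: (-1 - z)^n = (-1)^n (1 + z)^n, and the value (-1)^n B_n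
  of \<open>E\<close> on (1 + z)^n cancels the sign.\<close>

lemma bernoulli_umbra_reflect: "bernoulli_umbra (p \<circ>\<^sub>p [:-1, -1:]) = bernoulli_umbra p"
proof -
  have mon: "bernoulli_umbra (monom 1 n \<circ>\<^sub>p [:-1, -1:]) = bernoulli n" for n
  proof -
    have "monom 1 n \<circ>\<^sub>p [:-1, -1:] = ([:-1, -1:] :: rat poly) ^ n"
      by (simp add: monom_altdef pcompose_smult pcompose_power pcompose_pCons)
    also have "\<dots> = (smult (-1) [:1, 1:]) ^ n"
      by simp
    also have "\<dots> = smult ((-1) ^ n) ([:1, 1:] ^ n)"
      by (rule smult_power)
    finally have "bernoulli_umbra (monom 1 n \<circ>\<^sub>p [:-1, -1:])
        = (-1) ^ n * (\<Sum>i\<le>n. of_nat (n choose i) * bernoulli i)"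
      by (simp add: bernoulli_umbra_smult linear_power_expand bernoulli_umbra_sum
          bernoulli_umbra_monom)
    then show ?thesis
      by (simp add: bernoulli_binomial_sum)
  qed
  have "p = (\<Sum>i\<le>degree p. smult (coeff p i) (monom 1 i))"
    by (simp add: smult_monom poly_as_sum_of_monoms)
  then have "p \<circ>\<^sub>p [:-1, -1:] = (\<Sum>i\<le>degree p. smult (coeff p i) (monom 1 i)) \<circ>\<^sub>p [:-1, -1:]"
    by (rule arg_cong)
  also have "\<dots> = (\<Sum>i\<le>degree p. smult (coeff p i) (monom 1 i \<circ>\<^sub>p [:-1, -1:]))"
    by (simp only: pcompose_sum pcompose_smult)
  finally have "p \<circ>\<^sub>p [:-1, -1:] = (\<Sum>i\<le>degree p. smult (coeff p i) (monom 1 i \<circ>\<^sub>p [:-1, -1:]))" .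
  then show ?thesis
    by (simp add: bernoulli_umbra_sum bernoulli_umbra_smult mon)
       (simp add: bernoulli_umbra_def)
qed

section \<open>Divided derivatives under the functional\<close>

definition umbra_deriv :: "nat \<Rightarrow> rat poly \<Rightarrow> rat" where
  "umbra_deriv q p = bernoulli_umbra ((pderiv ^^ q) p) / fact q"

lemma higher_pderiv_reflect:
  "(pderiv ^^ q) (p \<circ>\<^sub>p [:-1, -1 :: rat:]) = smult ((-1) ^ q) ((pderiv ^^ q) p \<circ>\<^sub>p [:-1, -1:])"
  by (induction q) (simp_all add: pderiv_smult pderiv_pcompose pderiv_pCons)

lemma umbra_deriv_reflect:
  "umbra_deriv q (p \<circ>\<^sub>p [:-1, -1:]) = (-1) ^ q * umbra_deriv q p"
  by (simp add: umbra_deriv_def higher_pderiv_reflect bernoulli_umbra_smult bernoulli_umbra_reflect)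

lemma umbra_deriv_smult: "umbra_deriv q (smult c p) = c * umbra_deriv q p"
  by (simp add: umbra_deriv_def higher_pderiv_smult bernoulli_umbra_smult)

lemma umbra_deriv_sum: "umbra_deriv q (\<Sum>i\<in>A. f i) = (\<Sum>i\<in>A. umbra_deriv q (f i))"
  by (simp add: umbra_deriv_def higher_pderiv_sum bernoulli_umbra_sum sum_divide_distrib)

lemma umbra_deriv_eq_sum:
  assumes "degree p \<le> N + q"
  shows "umbra_deriv q p = (\<Sum>n\<le>N. of_nat ((n + q) choose n) * coeff p (n + q) * bernoulli n)"
proof -
  \<comment> \<open>The q-th derivative brings in the rising factorial (n + 1) ... (n + q); division
    by q! turns it into a binomial coefficient.\<close>
  have "pochhammer (of_nat (Suc n)) q = (fact q * of_nat ((n + q) choose n) :: rat)" for n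
  proof -
    have "fact n * pochhammer (of_nat (Suc n)) q = (fact (n + q) :: rat)"
      using pochhammer_product' [of "1 :: rat" n q] by (simp add: pochhammer_fact add.commute)
    also have "\<dots> = fact n * (fact q * of_nat ((n + q) choose n))"
      by (simp add: binomial_fact)
    finally show ?thesis by simp
  qed
  moreover have "degree ((pderiv ^^ q) p) \<le> N"
    using assms by (simp add: degree_higher_pderiv)
  ultimately show ?thesis
    by (simp add: umbra_deriv_def bernoulli_umbra_bound coeff_higher_pderiv sum_divide_distrib
        mult.assoc
        del: of_nat_Suc)
qed

lemma umbra_deriv_monom:
  "umbra_deriv q (monom 1 m) =
     (if q \<le> m then of_nat (m choose q) * bernoulli (m - q) else 0)"
proof -
  have "umbra_deriv q (monom 1 m) =
      (\<Sum>n\<le>m. of_nat ((n + q) choose n) * (if m = n + q then 1 else 0) * bernoulli n)"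
    by (subst umbra_deriv_eq_sum [of _ m]) (auto intro: order.trans [OF degree_monom_le])
  also have "\<dots> = (\<Sum>n\<le>m. if n = m - q then (if q \<le> m then of_nat (m choose q) * bernoulli (m - q) else 0) else 0)"
    by (intro sum.cong) (auto simp: binomial_symmetric [of q m])
  finally show ?thesis by simp
qed

section \<open>The sums occurring in the inverse matrix\<close>

text \<open>With d = 2K - 1 and q = 2s - 2, so that d - q = k - 2s, this is the second sum of the
  theorem for m = 2r - 1 and the first for m = k - 2r - 1.\<close>

definition bernoulli_conv :: "nat \<Rightarrow> nat \<Rightarrow> nat \<Rightarrow> rat" where
  "bernoulli_conv d q m =
     (\<Sum>n=0..d - q. of_nat (m choose (d - q - n)) * of_nat ((n + q) choose n) * bernoulli n)"

lemma bernoulli_conv_umbra: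
  assumes "m \<le> d" "q \<le> d"
  shows "bernoulli_conv d q m = umbra_deriv q ([:1, 1:] ^ m * [:0, 1:] ^ (d - m))"
proof -
  let ?p = "[:1, 1:] ^ m * [:0, 1:] ^ (d - m) :: rat poly"
  have "degree ?p \<le> degree ([:1, 1:] ^ m :: rat poly) + degree ([:0, 1:] ^ (d - m) :: rat poly)"
    by (rule degree_mult_le)
  also have "\<dots> = d"
    using assms by (simp add: degree_power_eq)
  finally have deg: "degree ?p \<le> (d - q) + q"
    using assms by simp
  \<comment> \<open>For j < d - m both sides vanish, because then d - j > m.\<close>
  have coeff: "coeff ?p j = of_nat (m choose (d - j))" if "j \<le> d" for j
  proof -
    have "?p = monom 1 (d - m) * (\<Sum>i\<le>m. monom (of_nat (m choose i)) i)"
      by (simp add: linear_power_expand monom_altdef mult.commute)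
    then have "coeff ?p j = (if d - m \<le> j then of_nat (m choose (j - (d - m))) else 0)"
      by (simp add: coeff_monom_mult coeff_sum binomial_eq_0)
    moreover have "m choose (j - (d - m)) = m choose (d - j)" if "d - m \<le> j"
      using assms \<open>j \<le> d\<close> that by (subst binomial_symmetric) (auto intro: arg_cong2 [where f = binomial])
    ultimately show ?thesis
      using that assms by (simp add: binomial_eq_0)
  qed
  show ?thesis
    unfolding umbra_deriv_eq_sum [OF deg] bernoulli_conv_def atMost_atLeast0
    using assms by (intro sum.cong) (simp_all add: coeff add.commute)
qed

text \<open>The map z -> -1 - z exchanges z and 1 + z up to sign; the d factors contribute (-1)^d =
  -1, and the q derivatives contribute (-1)^q = 1.\<close>

lemma bernoulli_conv_reflect:
  assumes "m \<le> d" "q \<le> d" "odd d" "even q"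
  shows "bernoulli_conv d q (d - m) = - bernoulli_conv d q m"
proof -
  let ?x = "[:0, 1:] :: rat poly" and ?y = "[:1, 1:] :: rat poly"
  have "(?y ^ m * ?x ^ (d - m)) \<circ>\<^sub>p [:-1, -1:] = (- ?x) ^ m * (- ?y) ^ (d - m)"
    by (simp add: pcompose_mult pcompose_power pcompose_pCons)
  also have "\<dots> = (-1) ^ (m + (d - m)) * (?x ^ m * ?y ^ (d - m))"
    by (subst (1 2) power_minus) (simp add: power_add mult_ac)
  also have "\<dots> = smult (-1) (?y ^ (d - m) * ?x ^ (d - (d - m)))"
    using assms by (simp add: mult.commute)
  finally have "(?y ^ m * ?x ^ (d - m)) \<circ>\<^sub>p [:-1, -1:] =
      smult (-1) (?y ^ (d - m) * ?x ^ (d - (d - m)))" .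
  then have "- umbra_deriv q (?y ^ (d - m) * ?x ^ (d - (d - m))) = umbra_deriv q (?y ^ m * ?x ^ (d - m))"
    using umbra_deriv_reflect [of q "?y ^ m * ?x ^ (d - m)"] \<open>even q\<close>
    by (simp only: umbra_deriv_smult) simp
  then show ?thesis
    using assms by (simp add: bernoulli_conv_umbra)
qed

text \<open>Pulling out z^(d - N) leaves the binomial expansion of (z - (1 + z))^N = 1, so only the
  value on one monomial remains.\<close>

lemma bernoulli_conv_alternating_sum:
  assumes "N \<le> d" "q \<le> d" "even N"
  shows "(\<Sum>m\<le>N. (-1) ^ m * of_nat (N choose m) * bernoulli_conv d q m) =
    (if q \<le> d - N then of_nat ((d - N) choose q) * bernoulli (d - N - q) else 0)"
proof -
  let ?x = "[:0, 1:] :: rat poly" and ?y = "[:1, 1:] :: rat poly"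
  have "(\<Sum>m\<le>N. (-1) ^ m * of_nat (N choose m) * bernoulli_conv d q m) =
      umbra_deriv q (\<Sum>m\<le>N. smult ((-1) ^ m * of_nat (N choose m)) (?y ^ m * ?x ^ (d - m)))"
    using assms by (simp add: umbra_deriv_sum umbra_deriv_smult bernoulli_conv_umbra)
  also have "(\<Sum>m\<le>N. smult ((-1) ^ m * of_nat (N choose m)) (?y ^ m * ?x ^ (d - m))) =
      (\<Sum>m\<le>N. of_nat (N choose m) * (- ?y) ^ m * ?x ^ (N - m)) * ?x ^ (d - N)"
    unfolding sum_distrib_right
  proof (intro sum.cong refl)
    fix m assume "m \<in> {..N}"
    then have "?x ^ (d - m) = ?x ^ (N - m) * ?x ^ (d - N)"
      using assms by (simp flip: power_add)
    moreover have "(- ?y) ^ m = smult ((-1) ^ m) (?y ^ m)"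
      by (metis smult_power smult_minus_left smult_1_left)
    ultimately show "smult ((-1) ^ m * of_nat (N choose m)) (?y ^ m * ?x ^ (d - m)) =
        of_nat (N choose m) * (- ?y) ^ m * ?x ^ (N - m) * ?x ^ (d - N)"
      by (simp add: of_nat_poly mult_ac)
  qed
  also have "(\<Sum>m\<le>N. of_nat (N choose m) * (- ?y) ^ m * ?x ^ (N - m)) = (- ?y + ?x) ^ N"
    by (rule binomial_ring [symmetric])
  also have "- ?y + ?x = - 1"
    by (simp add: one_pCons)
  also have "(- 1) ^ N * ?x ^ (d - N) = monom 1 (d - N)"
    using assms by (simp add: monom_altdef)
  finally show ?thesis
    by (simp add: umbra_deriv_monom)
qed

section \<open>The matrix, its inverse and the entry formulas\<close>

text \<open>Running through the even indices downwards matches the pairing of the two binomials in a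
  matrix entry.\<close>

lemma sum_lessThan_double_odd_reversed_even:
  fixes f :: "nat \<Rightarrow> 'a :: comm_monoid_add"
  shows "(\<Sum>m<2 * K. f m) = (\<Sum>i<K. f (2 * i + 1) + f (2 * K - 2 * (i + 1)))"
proof -
  have "(\<Sum>m<2 * K. f m) = (\<Sum>i<K. f (2 * i + 1)) + (\<Sum>i<K. f (2 * i))"
    by (induction K) (simp_all add: ac_simps)
  also have "(\<Sum>i<K. f (2 * i)) = (\<Sum>i<K. f (2 * (K - Suc i)))"
    by (rule sum.nat_diff_reindex [symmetric])
  finally show ?thesis
    by (simp add: sum.distrib diff_mult_distrib2)
qed

definition C_inv :: "nat \<Rightarrow> rat mat" where
  "C_inv K = mat (K - 1) (K - 1) (\<lambda>(i, j).
     2 / of_nat (2 * j + 1) * bernoulli_conv (2 * K - 1) (2 * j) (2 * i + 1))"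

lemma C_mat_row_sum:
  assumes "s \<in> {1..<K}" "t < K - 1"
  shows "(\<Sum>i<K - 1. (of_nat ((2 * K - 2 * s) choose (2 * i + 1)) +
        of_nat ((2 * K - 2 * s) choose (2 * K - 2 * (i + 1)))) *
        bernoulli_conv (2 * K - 1) (2 * t) (2 * i + 1)) =
      (if s = t + 1 then of_nat (2 * t + 1) / 2 else 0)"
    (is "?lhs = _")
proof -
  let ?d = "2 * K - 1" and ?N = "2 * K - 2 * s"
  let ?\<phi> = "bernoulli_conv ?d (2 * t)"
  let ?f = "\<lambda>m. (-1) ^ m * of_nat (?N choose m) * ?\<phi> m"
  have conv_reflect: "?\<phi> (2 * K - 2 * (i + 1)) = - ?\<phi> (2 * i + 1)" if "i < K" for i
  proof -
    have "2 * K - 2 * (i + 1) = ?d - (2 * i + 1)" by simp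
    then show ?thesis
      using that assms by (simp only: bernoulli_conv_reflect) (subst bernoulli_conv_reflect; simp)
  qed
  \<comment> \<open>The case N = 0 of the alternating sum gives a multiple of the Bernoulli number
    of index 2K - 1 - 2t, which is odd and at least 3.\<close>
  have "?\<phi> 0 = 0"
  proof -
    have "(\<Sum>m\<le>0. (-1) ^ m * of_nat (0 choose m) * ?\<phi> m) = 0"
      by (subst bernoulli_conv_alternating_sum) (use assms in \<open>auto intro!: bernoulli_odd_eq_0\<close>)
    then show ?thesis by simp
  qed
  \<comment> \<open>At odd m the sign is that of (-1)^m, at even m it comes from
    \<open>conv_reflect\<close>.\<close>
  have "?lhs = - (\<Sum>i<K - 1. ?f (2 * i + 1) + ?f (2 * K - 2 * (i + 1)))"
    unfolding sum_negf [symmetric]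
    by (intro sum.cong refl, subst conv_reflect) (auto simp: algebra_simps)
  \<comment> \<open>The added pair has m = 2K - 1, where the binomial vanishes, and m = 0, where
    \<phi> does.\<close>
  also have "(\<Sum>i<K - 1. ?f (2 * i + 1) + ?f (2 * K - 2 * (i + 1))) =
      (\<Sum>i<K. ?f (2 * i + 1) + ?f (2 * K - 2 * (i + 1)))"
  proof -
    obtain M where K: "K = Suc M" "s \<le> M" "s \<ge> 1"
      using assms by (cases K) auto
    then have "?f (2 * M + 1) + ?f (2 * K - 2 * (M + 1)) = 0"
      using \<open>?\<phi> 0 = 0\<close> by (simp add: binomial_eq_0)
    with K(1) show ?thesis
      by (simp only: sum.lessThan_Suc diff_Suc_1 add_0_right)
  qed
  also have "\<dots> = (\<Sum>m<2 * K. ?f m)"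
    by (rule sum_lessThan_double_odd_reversed_even [symmetric])
  also have "\<dots> = (\<Sum>m\<le>?N. ?f m)"
    using assms by (intro sum.mono_neutral_right) (auto simp: binomial_eq_0)
  also have "\<dots> = (if 2 * t \<le> ?d - ?N then of_nat ((?d - ?N) choose (2 * t)) *
      bernoulli (?d - ?N - 2 * t) else 0)"
    using assms by (intro bernoulli_conv_alternating_sum) auto
  also have "?d - ?N = 2 * s - 1"
    using assms by auto
  \<comment> \<open>For s = t + 1 the value is -(2t + 1) B_1 with B_1 = -1/2; for larger s the index
    is odd and exceeds 1.\<close>
  finally show ?thesis
    using assms bernoulli_1 by (auto simp: bernoulli_odd_eq_0)
qed

lemma C_mat_mult_C_inv: "C_mat K * C_inv K = 1\<^sub>m (K - 1)"
proof (rule eq_matI)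
  fix i j assume "i < dim_row (1\<^sub>m (K - 1) :: rat mat)" "j < dim_col (1\<^sub>m (K - 1) :: rat mat)"
  then have ij: "i < K - 1" "j < K - 1" by auto
  then have "(C_mat K * C_inv K) $$ (i, j) =
     2 / of_nat (2 * j + 1) * (\<Sum>l<K - 1. (of_nat ((2 * K - 2 * (i + 1)) choose (2 * l + 1)) +
        of_nat ((2 * K - 2 * (i + 1)) choose (2 * K - 2 * (l + 1)))) *
        bernoulli_conv (2 * K - 1) (2 * j) (2 * l + 1))"
    unfolding sum_distrib_left atLeast0LessThan [symmetric]
    by (auto simp: C_mat_def C_inv_def scalar_prod_def intro!: sum.cong)
  also have "\<dots> = (if i = j then 1 else 0)"
    using ij by (subst C_mat_row_sum) auto
  finally show "(C_mat K * C_inv K) $$ (i, j) = 1\<^sub>m (K - 1) $$ (i, j)"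
    using ij by simp
qed (simp_all add: C_mat_def C_inv_def)

lemma C_mat_carrier: "C_mat K \<in> carrier_mat (K - 1) (K - 1)"
  by (simp add: C_mat_def)

lemma C_inv_carrier: "C_inv K \<in> carrier_mat (K - 1) (K - 1)"
  by (simp add: C_inv_def)

lemma C_inv_mult_C_mat: "C_inv K * C_mat K = 1\<^sub>m (K - 1)"
  by (rule mat_mult_left_right_inverse [OF C_mat_carrier C_inv_carrier C_mat_mult_C_inv])

lemma C_mat_inverse_unique:
  assumes "inverts_mat (C_mat K) D" "inverts_mat D (C_mat K)"
  shows "D = C_inv K"
proof -
  have CD: "C_mat K * D = 1\<^sub>m (K - 1)" and DC: "D * C_mat K = 1\<^sub>m (dim_row D)"
    using assms C_mat_carrier [of K] by (auto simp: inverts_mat_def)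
  \<comment> \<open>\<open>inverts_mat\<close> leaves the shape of \<open>D\<close> open; the column
    counts of the two products determine it.\<close>
  have "D \<in> carrier_mat (K - 1) (K - 1)"
    using arg_cong [OF CD, of dim_col] arg_cong [OF DC, of dim_col] C_mat_carrier [of K] by auto
  then show ?thesis
    using CD C_inv_mult_C_mat [of K] C_mat_carrier [of K] C_inv_carrier [of K]
    by (metis assoc_mult_mat left_mult_one_mat right_mult_one_mat)
qed

theorem theorem1:
  fixes k K :: nat
  assumes "k = 2 * K + 1" and "k \<ge> 5"
  shows "invertible_mat (C_mat K) \<and>
    (\<forall>D. inverts_mat (C_mat K) D \<and> inverts_mat D (C_mat K) \<longrightarrow>
      (\<forall>r\<in>{1..K - 1}. \<forall>s\<in>{1..K - 1}.
        D $$ (r - 1, s - 1) =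
          - 2 / of_nat (2 * s - 1) *
            (\<Sum>n = 0..k - 2 * s. of_nat ((k - 2 * r - 1) choose (k - 2 * s - n)) *
               of_nat ((n + 2 * s - 2) choose n) * bernoulli n) \<and>
        D $$ (r - 1, s - 1) =
          2 / of_nat (2 * s - 1) *
            (\<Sum>n = 0..k - 2 * s. of_nat ((2 * r - 1) choose (k - 2 * s - n)) *
               of_nat ((n + 2 * s - 2) choose n) * bernoulli n)))"
proof (intro conjI allI impI ballI)
  show "invertible_mat (C_mat K)"
    unfolding invertible_mat_def inverts_mat_def
    using C_mat_mult_C_inv [of K] C_inv_mult_C_mat [of K] C_mat_carrier [of K] C_inv_carrier [of K]
    by (auto intro!: exI [of _ "C_inv K"])
next
  fix D r s
  assume "inverts_mat (C_mat K) D \<and> inverts_mat D (C_mat K)"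
    and r: "r \<in> {1..K - 1}" and s: "s \<in> {1..K - 1}"
  then have D: "D = C_inv K"
    by (simp add: C_mat_inverse_unique)
  have conv: "(\<Sum>n = 0..k - 2 * s. of_nat (m choose (k - 2 * s - n)) *
      of_nat ((n + 2 * s - 2) choose n) * bernoulli n) = bernoulli_conv (2 * K - 1) (2 * (s - 1)) m" for m
  proof -
    have "k - 2 * s = 2 * K - 1 - 2 * (s - 1)" "\<And>n. n + 2 * s - 2 = n + 2 * (s - 1)"
      using assms s by auto
    then show ?thesis by (simp only: bernoulli_conv_def)
  qed
  have entry: "D $$ (r - 1, s - 1) =
      2 / of_nat (2 * s - 1) * bernoulli_conv (2 * K - 1) (2 * (s - 1)) (2 * r - 1)"
  proof -
    have "2 * (s - 1) + 1 = 2 * s - 1" "2 * (r - 1) + 1 = 2 * r - 1" "r - 1 < K - 1" "s - 1 < K - 1"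
      using r s by auto
    then show ?thesis
      unfolding D C_inv_def by (simp only: index_mat prod.case)
  qed
  then show "D $$ (r - 1, s - 1) =
          2 / of_nat (2 * s - 1) *
            (\<Sum>n = 0..k - 2 * s. of_nat ((2 * r - 1) choose (k - 2 * s - n)) *
               of_nat ((n + 2 * s - 2) choose n) * bernoulli n)"
    by (simp only: conv)
  \<comment> \<open>The first formula is the second one at the reflected argument, which accounts
    for its minus sign.\<close>
  have "bernoulli_conv (2 * K - 1) (2 * (s - 1)) (2 * K - 1 - (2 * r - 1)) =
      - bernoulli_conv (2 * K - 1) (2 * (s - 1)) (2 * r - 1)"
    using r s by (intro bernoulli_conv_reflect) auto
  moreover have "2 * K - 1 - (2 * r - 1) = k - 2 * r - 1"
    using assms r by auto
  ultimately show "D $$ (r - 1, s - 1) =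
          - 2 / of_nat (2 * s - 1) *
            (\<Sum>n = 0..k - 2 * s. of_nat ((k - 2 * r - 1) choose (k - 2 * s - n)) *
               of_nat ((n + 2 * s - 2) choose n) * bernoulli n)"
    unfolding conv entry by simp
qed

end
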